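(* Let $F$ be a field of characteristic not $2$, let $K$ and $L$ be two finite field extensions of $F$, let $\sigma\in\mathrm{Aut}_F(K)$ and $\phi\in\mathrm{Aut}_F(L)$ be non-trivial automorphisms, and let $c\in K^{\times}$, $d\in L^{\times}$. Put $D=D(K,\sigma,c)$ and $D'=D(L,\phi,d)$. Then a map $G:D\to D'$ is an isomorphism of $F$-algebras if and only if $G$ has the form $$G(x,y)=(\tau(x),\tau(y)b)\qquad (x,y\in K)$$ for some $F$-isomorphism $\tau:K\to L$ and some $b\in L^{\times}$ such that (i) $\phi\circ\tau=\tau\circ\sigma$, and (ii) $\tau(c)=d\,\phi(b^2)$. Moreover, for an $F$-isomorphism $\tau:K\to L$ satisfying (i), there exists $b\in L^{\times}$ satisfying (ii) if and only if $\tau(c)d^{-1}$ is a square in $L^{\times}$.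
   Context: For a finite field extension $K/F$, $\sigma\in\mathrm{Aut}_F(K)$ and $c\in K^{\times}$, $D(K,\sigma,c)$ denotes the $F$-vector space $K\oplus K$ with multiplication $(u,v)(x,y)=(ux+c\,\sigma(vy),\,uy+vx)$ for $u,v,x,y\in K$; it is a unital commutative, not necessarily associative, $F$-algebra. *)

theory Defs
  imports
    "HOL-Library.Product_Plus"
    "HOL-Computational_Algebra.Computational_Algebra"
    "Jordan_Normal_Form.Matrix"
begin

text \<open>
  A field extension \<open>K/F\<close> is an embedding \<open>i :: 'f \<Rightarrow> 'k\<close> of fields; the field \<open>K\<close> is then an
  \<open>F\<close>-vector space via \<open>ext_scale i\<close>.
\<close>

definition ext_scale :: "('f::field \<Rightarrow> 'k::field) \<Rightarrow> 'f \<Rightarrow> 'k \<Rightarrow> 'k" where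
  "ext_scale i a x = i a * x"

definition finite_extension :: "('f::field \<Rightarrow> 'k::field) \<Rightarrow> bool" where
  "finite_extension i \<longleftrightarrow> field_hom i \<and> (\<exists>B. finite_dimensional_vector_space (ext_scale i) B)"

definition ext_isom ::
    "('f::field \<Rightarrow> 'k::field) \<Rightarrow> ('f \<Rightarrow> 'l::field) \<Rightarrow> ('k \<Rightarrow> 'l) \<Rightarrow> bool" where
  "ext_isom i j \<tau> \<longleftrightarrow> field_isom \<tau> \<and> (\<forall>a. \<tau> (i a) = j a)"

definition ext_Aut :: "('f::field \<Rightarrow> 'k::field) \<Rightarrow> ('k \<Rightarrow> 'k) set" where
  "ext_Aut i = {\<sigma>. ext_isom i i \<sigma>}"

text \<open>Algebras over a field, not assumed to be associative, commutative or unital.\<close>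

locale nonassoc_algebra = vector_space scale
  for scale :: "'f::field \<Rightarrow> 'a::ab_group_add \<Rightarrow> 'a" +
  fixes mul :: "'a \<Rightarrow> 'a \<Rightarrow> 'a"
  assumes mul_add_left: "mul (x + y) z = mul x z + mul y z"
    and mul_add_right: "mul x (y + z) = mul x y + mul x z"
    and mul_scale_left: "mul (scale a x) y = scale a (mul x y)"
    and mul_scale_right: "mul x (scale a y) = scale a (mul x y)"

locale nonassoc_algebra_isom =
  A: nonassoc_algebra sA mA + B: nonassoc_algebra sB mB + Vector_Spaces.linear sA sB G
  for sA :: "'f::field \<Rightarrow> 'a::ab_group_add \<Rightarrow> 'a" and mA :: "'a \<Rightarrow> 'a \<Rightarrow> 'a"
    and sB :: "'f \<Rightarrow> 'b::ab_group_add \<Rightarrow> 'b" and mB :: "'b \<Rightarrow> 'b \<Rightarrow> 'b"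
    and G :: "'a \<Rightarrow> 'b" +
  assumes bij: "bij G"
    and map_mul: "G (mA x y) = mB (G x) (G y)"

text \<open>
  The algebra \<open>D(K, \<sigma>, c)\<close>: its additive group is the product type \<open>'k \<times> 'k\<close> with
  componentwise addition.
\<close>

definition D_scale :: "('f::field \<Rightarrow> 'k::field) \<Rightarrow> 'f \<Rightarrow> 'k \<times> 'k \<Rightarrow> 'k \<times> 'k" where
  "D_scale i a = (\<lambda>(u, v). (ext_scale i a u, ext_scale i a v))"

definition D_mul :: "('k::field \<Rightarrow> 'k) \<Rightarrow> 'k \<Rightarrow> 'k \<times> 'k \<Rightarrow> 'k \<times> 'k \<Rightarrow> 'k \<times> 'k" where
  "D_mul \<sigma> c = (\<lambda>(u, v) (x, y). (u * x + c * \<sigma> (v * y), u * y + v * x))"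

lemma nonassoc_algebra_D:
  assumes "field_hom i" and "\<sigma> \<in> ext_Aut i"
  shows "nonassoc_algebra (D_scale i) (D_mul \<sigma> c)"
proof -
  interpret i: field_hom i by fact
  interpret \<sigma>: field_isom \<sigma> using assms(2) by (simp add: ext_Aut_def ext_isom_def)
  have fix_F: "\<sigma> (i a) = i a" for a using assms(2) by (simp add: ext_Aut_def ext_isom_def)
  show ?thesis
    by unfold_locales
      (auto simp: D_scale_def D_mul_def ext_scale_def i.hom_add i.hom_mult \<sigma>.hom_add \<sigma>.hom_mult
        fix_F algebra_simps)
qed

lemma D_mul_commute: "D_mul \<sigma> c p q = D_mul \<sigma> c q p"
  by (auto simp: D_mul_def algebra_simps split: prod.splits)

lemma D_mul_one:
  assumes "\<sigma> \<in> ext_Aut i"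
  shows "D_mul \<sigma> c (1, 0) p = p"
proof -
  interpret \<sigma>: field_isom \<sigma> using assms by (simp add: ext_Aut_def ext_isom_def)
  show ?thesis by (auto simp: D_mul_def split: prod.splits)
qed

end

theory Submission
  imports Defs
begin

text \<open>
  Since \<open>\<sigma>\<close> is non-trivial, the middle nucleus of \<open>D(K, \<sigma>, c)\<close> is exactly \<open>K \<oplus> 0\<close>. An isomorphism
  \<open>G\<close> preserves middle nuclei, hence restricts to an \<open>F\<close>-isomorphism \<open>\<tau> : K \<rightarrow> L\<close>, and is then
  determined by \<open>G(0, 1) = (a, b)\<close>. Applying \<open>G\<close> to \<open>(0, 1)(0, y) = (c \<sigma>(y), 0)\<close> yields
  \<open>2 a b \<tau>(y) = 0\<close>, so \<open>a = 0\<close>, and \<open>\<tau>(c) \<tau>(\<sigma>(y)) = d \<phi>(b\<^sup>2) \<phi>(\<tau>(y))\<close>; the conditions (ii) and (i)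
  follow by taking first \<open>y = 1\<close> and then \<open>y\<close> arbitrary.
\<close>

definition middle_nucleus :: "('a \<Rightarrow> 'a \<Rightarrow> 'a) \<Rightarrow> 'a set" where
  "middle_nucleus m = {q. \<forall>p r. m (m p q) r = m p (m q r)}"

text \<open>Surjectivity lets the quantified outer factors in the target be taken as images under
  \<open>G\<close>. Multiplicativity then pulls \<open>G\<close> out of both products, and
  injectivity cancels it.\<close>

lemma middle_nucleus_hom_iff:
  assumes "bij G" and hom: "\<And>x y. G (m x y) = m' (G x) (G y)"
  shows "G q \<in> middle_nucleus m' \<longleftrightarrow> q \<in> middle_nucleus m"
proof -
  have "G q \<in> middle_nucleus m' \<longleftrightarrow>
      (\<forall>p r. m' (m' (G p) (G q)) (G r) = m' (G p) (m' (G q) (G r)))"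
    unfolding middle_nucleus_def mem_Collect_eq by (metis assms(1) bij_pointE)
  also have "\<dots> \<longleftrightarrow> q \<in> middle_nucleus m"
    unfolding middle_nucleus_def mem_Collect_eq hom[symmetric]
    using bij_is_inj[OF assms(1)] by (simp add: inj_eq)
  finally show ?thesis .
qed

lemma middle_nucleus_D_mul:
  assumes "field_isom \<sigma>" and "\<sigma> \<noteq> id" and "c \<noteq> 0"
  shows "(u, v) \<in> middle_nucleus (D_mul \<sigma> c) \<longleftrightarrow> v = 0"
proof -
  interpret \<sigma>: field_isom \<sigma> by fact
  show ?thesis
  proof
    assume mem: "(u, v) \<in> middle_nucleus (D_mul \<sigma> c)"
    obtain x where x: "\<sigma> x \<noteq> x" using assms(2) by (auto simp: fun_eq_iff)
    \<comment> \<open>With these outer factors the second components of the two products agree, and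
      the first differ by \<open>c * \<sigma> v * (\<sigma> x - x)\<close>. So an element
      \<open>x\<close> moved by \<open>\<sigma>\<close> detects \<open>v\<close>.\<close>
    have "D_mul \<sigma> c (D_mul \<sigma> c (x, 0) (u, v)) (0, 1) = D_mul \<sigma> c (x, 0) (D_mul \<sigma> c (u, v) (0, 1))"
      using mem by (simp add: middle_nucleus_def)
    then have "c * \<sigma> v * (\<sigma> x - x) = 0"
      by (simp add: D_mul_def \<sigma>.hom_mult algebra_simps)
    with x assms(3) show "v = 0" by simp
  next
    assume "v = 0"
    then show "(u, v) \<in> middle_nucleus (D_mul \<sigma> c)"
      by (auto simp: middle_nucleus_def D_mul_def algebra_simps)
  qed
qed

text \<open>This allows the factor 2 in \<open>2 * (a * b) = 0\<close> to be cancelled over the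
  larger field. As \<open>j\<close> is injective, 2 = 0 there would force 2 = 0 in the base field,
  whose characteristic would then divide 2.\<close>

lemma field_hom_two_neq_zero:
  fixes j :: "'f::field \<Rightarrow> 'l::field"
  assumes "field_hom j" and "CHAR('f) \<noteq> 2"
  shows "(2::'l) \<noteq> 0"
proof
  interpret j: field_hom j by fact
  assume "(2::'l) = 0"
  then have "j (of_nat 2) = 0" by (simp add: j.hom_of_nat del: of_nat_numeral) simp
  then have "CHAR('f) dvd 2" by (simp only: j.hom_0_iff of_nat_eq_0_iff_char_dvd)
  then have "CHAR('f) = 1 \<or> CHAR('f) = 2"
    using two_is_prime_nat unfolding prime_nat_iff by blast
  then show False using assms(2) CHAR_not_1' by auto
qed

lemma D_isom_imp_form:
  fixes i :: "'f::field \<Rightarrow> 'k::field" and j :: "'f \<Rightarrow> 'l::field"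
  assumes two: "(2::'l) \<noteq> 0"
    and \<sigma>: "field_isom \<sigma>" "\<sigma> \<noteq> id" and \<phi>: "field_isom \<phi>" "\<phi> \<noteq> id"
    and c: "c \<noteq> 0" and d: "d \<noteq> 0"
    and G: "nonassoc_algebra_isom (D_scale i) (D_mul \<sigma> c) (D_scale j) (D_mul \<phi> d) G"
  shows "\<exists>\<tau> b. ext_isom i j \<tau> \<and> b \<noteq> 0 \<and> (\<forall>x y. G (x, y) = (\<tau> x, \<tau> y * b)) \<and>
                \<phi> \<circ> \<tau> = \<tau> \<circ> \<sigma> \<and> \<tau> c = d * \<phi> (b\<^sup>2)"
proof -
  interpret G: nonassoc_algebra_isom "D_scale i" "D_mul \<sigma> c" "D_scale j" "D_mul \<phi> d" G by (rule G)
  interpret \<sigma>: field_isom \<sigma> by (rule \<sigma>(1))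
  interpret \<phi>: field_isom \<phi> by (rule \<phi>(1))
  define \<tau> where "\<tau> x = fst (G (x, 0))" for x
  obtain a b where ab: "G (0, 1) = (a, b)" by force
  \<comment> \<open>On both sides the middle nucleus is the set of pairs with vanishing second
    component, and \<open>G\<close> preserves and reflects it. Reflection is what makes
    \<open>\<tau>\<close> surjective and \<open>b\<close> nonzero below.\<close>
  have nucl: "snd (G q) = 0 \<longleftrightarrow> snd q = 0" for q
    using middle_nucleus_hom_iff[of G "D_mul \<sigma> c" "D_mul \<phi> d" q, OF G.bij G.map_mul]
      middle_nucleus_D_mul[OF \<sigma> c, of "fst q" "snd q"]
      middle_nucleus_D_mul[OF \<phi> d, of "fst (G q)" "snd (G q)"]
    by simp
  have \<tau>: "G (x, 0) = (\<tau> x, 0)" for x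
    using nucl[of "(x, 0)"] by (simp add: \<tau>_def prod_eq_iff)
  have \<tau>_add: "\<tau> (x + y) = \<tau> x + \<tau> y" for x y
    using G.add[of "(x, 0)" "(y, 0)"] by (simp add: \<tau>)
  have \<tau>_mult: "\<tau> (x * y) = \<tau> x * \<tau> y" for x y
    using G.map_mul[of "(x, 0)" "(y, 0)"] by (simp add: \<tau> D_mul_def)
  have \<tau>_inj: "x = y" if "\<tau> x = \<tau> y" for x y
    using that \<tau> bij_is_inj[OF G.bij] by (metis injD prod.inject)
  have \<tau>_surj: "\<exists>x. \<tau> x = y" for y
  proof -
    obtain q where "G q = (y, 0)" using G.bij by (metis bij_pointE)
    then show ?thesis using nucl[of q] \<tau> by (metis fst_conv snd_conv surjective_pairing)
  qed
  have \<tau>_0: "\<tau> 0 = 0" using \<tau>_add[of 0 0] by (metis add_cancel_right_right add_0_left)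
  \<comment> \<open>\<open>\<tau> 1\<close> is idempotent, and nonzero by injectivity.\<close>
  have \<tau>_1: "\<tau> 1 = 1"
    using \<tau>_mult[of 1 1] \<tau>_inj[of 1 0] \<tau>_0 by auto
  have "\<tau> (i r) = j r" for r
    using G.scale[of r "(1, 0)"] by (simp add: \<tau> D_scale_def ext_scale_def \<tau>_0 \<tau>_1)
  moreover have "field_isom \<tau>"
  proof unfold_locales
    show "surj \<tau>" using \<tau>_surj by (metis surjI)
  qed (fact \<tau>_0 \<tau>_1 \<tau>_add \<tau>_mult)+
  ultimately have isom: "ext_isom i j \<tau>" by (simp add: ext_isom_def)
  have b: "b \<noteq> 0" using nucl[of "(0, 1)"] ab by simp
  \<comment> \<open>Comes from the factorization (0, y) = (y, 0)(0, 1).\<close>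
  have G_snd: "G (0, y) = (\<tau> y * a, \<tau> y * b)" for y
    using G.map_mul[of "(y, 0)" "(0, 1)"] by (simp add: D_mul_def \<tau> ab)
  have key: "(\<tau> c * \<tau> (\<sigma> y), 0) =
      (a * (\<tau> y * a) + d * \<phi> (b * (\<tau> y * b)), a * (\<tau> y * b) + b * (\<tau> y * a))" for y
    using G.map_mul[of "(0, 1)" "(0, y)"] by (simp add: D_mul_def \<tau> G_snd \<tau>_mult \<tau>_1)
  have "2 * (a * b) = 0" using key[of 1] by (simp add: \<tau>_1 mult.commute)
  with two b have a: "a = 0" by simp
  have \<tau>_c: "\<tau> c = d * \<phi> (b\<^sup>2)"
    using key[of 1] by (simp add: a \<tau>_1 power2_eq_square)
  have "\<phi> \<circ> \<tau> = \<tau> \<circ> \<sigma>"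
  proof
    fix y
    \<comment> \<open>Multiplicativity of \<open>\<phi>\<close> splits off the factor
      \<open>d * \<phi> (b\<^sup>2)\<close>, which is \<open>\<tau> c\<close> and can be
      cancelled.\<close>
    have "\<tau> c * \<tau> (\<sigma> y) = \<tau> c * \<phi> (\<tau> y)"
      using key[of y] by (simp add: a \<tau>_c power2_eq_square \<phi>.hom_mult)
    moreover have "\<tau> c \<noteq> 0" using \<tau>_inj[of c 0] \<tau>_0 c by auto
    ultimately show "(\<phi> \<circ> \<tau>) y = (\<tau> \<circ> \<sigma>) y" by simp
  qed
  moreover have "G (x, y) = (\<tau> x, \<tau> y * b)" for x y
    using G.add[of "(x, 0)" "(0, y)"] by (simp add: \<tau> G_snd a)
  ultimately show ?thesis using isom b \<tau>_c by blast
qed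

text \<open>Multiplicativity rests on the twisted term: (i) moves \<open>\<tau>\<close> past
  \<open>\<sigma>\<close>, and (ii) absorbs the two factors \<open>b\<close> contributed by the
  second components into \<open>\<tau> c\<close>.\<close>

lemma D_isom_of_form:
  fixes i :: "'f::field \<Rightarrow> 'k::field" and j :: "'f \<Rightarrow> 'l::field"
  assumes ext: "field_hom i" "field_hom j" and \<sigma>: "\<sigma> \<in> ext_Aut i" and \<phi>: "\<phi> \<in> ext_Aut j"
    and \<tau>: "ext_isom i j \<tau>" and b: "b \<noteq> 0" and G: "\<And>x y. G (x, y) = (\<tau> x, \<tau> y * b)"
    and comm: "\<phi> \<circ> \<tau> = \<tau> \<circ> \<sigma>" and \<tau>_c: "\<tau> c = d * \<phi> (b\<^sup>2)"
  shows "nonassoc_algebra_isom (D_scale i) (D_mul \<sigma> c) (D_scale j) (D_mul \<phi> d) G"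
proof -
  interpret A: nonassoc_algebra "D_scale i" "D_mul \<sigma> c" by (rule nonassoc_algebra_D[OF ext(1) \<sigma>])
  interpret B: nonassoc_algebra "D_scale j" "D_mul \<phi> d" by (rule nonassoc_algebra_D[OF ext(2) \<phi>])
  interpret \<tau>: field_isom \<tau> using \<tau> by (simp add: ext_isom_def)
  interpret \<phi>: field_isom \<phi> using \<phi> by (simp add: ext_Aut_def ext_isom_def)
  have \<tau>_i: "\<tau> (i r) = j r" for r using \<tau> by (simp add: ext_isom_def)
  have \<tau>_\<sigma>: "\<tau> (\<sigma> x) = \<phi> (\<tau> x)" for x using fun_cong[OF comm, of x] unfolding o_apply by (rule sym)
  have "inj G"
    by (rule injI) (use b in \<open>auto simp: G\<close>)
  moreover have "surj G"
    unfolding surj_def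
  proof
    fix q
    \<comment> \<open>Dividing by \<open>b\<close> undoes the scaling of the second
      component.\<close>
    obtain x y where "fst q = \<tau> x" "snd q / b = \<tau> y" using \<tau>.surj by (metis surjD)
    then have "q = G (x, y)" using b by (simp add: G prod_eq_iff field_simps del: \<tau>.f_eq_iff)
    then show "\<exists>p. q = G p" ..
  qed
  ultimately have "bij G" by (rule bijI)
  then show ?thesis
    by unfold_locales
      (auto simp: G D_scale_def D_mul_def ext_scale_def \<tau>_i \<tau>_\<sigma> \<tau>_c \<tau>.hom_add \<tau>.hom_mult
        \<phi>.hom_mult power2_eq_square algebra_simps)
qed

text \<open>The witnesses correspond by e = \<open>\<phi> b\<close>: \<open>\<phi>\<close> is
  bijective and commutes with squaring.\<close>

lemma ex_twisted_square_iff: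
  fixes \<phi> :: "'l::field \<Rightarrow> 'l"
  assumes "field_isom \<phi>" and d: "d \<noteq> 0"
  shows "(\<exists>b. b \<noteq> 0 \<and> t = d * \<phi> (b\<^sup>2)) \<longleftrightarrow> (\<exists>e. e \<noteq> 0 \<and> t * inverse d = e\<^sup>2)"
proof -
  interpret \<phi>: field_isom \<phi> by fact
  have "(\<exists>e. e \<noteq> 0 \<and> t * inverse d = e\<^sup>2) \<longleftrightarrow> (\<exists>b. \<phi> b \<noteq> 0 \<and> t * inverse d = (\<phi> b)\<^sup>2)"
    using \<phi>.surj by (metis surjD)
  also have "\<dots> \<longleftrightarrow> (\<exists>b. b \<noteq> 0 \<and> t = d * \<phi> (b\<^sup>2))"
    using d by (simp add: \<phi>.hom_power field_simps)
  finally show ?thesis ..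
qed

theorem theorem2p12:
  fixes i :: "'f::field \<Rightarrow> 'k::field" and j :: "'f \<Rightarrow> 'l::field"
    and \<sigma> :: "'k \<Rightarrow> 'k" and \<phi> :: "'l \<Rightarrow> 'l" and c :: 'k and d :: 'l
  assumes "CHAR('f) \<noteq> 2"
    and "finite_extension i" and "finite_extension j"
    and "\<sigma> \<in> ext_Aut i" and "\<sigma> \<noteq> id"
    and "\<phi> \<in> ext_Aut j" and "\<phi> \<noteq> id"
    and "c \<noteq> 0" and "d \<noteq> 0"
  shows "(\<forall>G :: 'k \<times> 'k \<Rightarrow> 'l \<times> 'l.
            nonassoc_algebra_isom (D_scale i) (D_mul \<sigma> c) (D_scale j) (D_mul \<phi> d) G \<longleftrightarrow>
            (\<exists>\<tau> b. ext_isom i j \<tau> \<and> b \<noteq> 0 \<and> (\<forall>x y. G (x, y) = (\<tau> x, \<tau> y * b)) \<and>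
                   \<phi> \<circ> \<tau> = \<tau> \<circ> \<sigma> \<and> \<tau> c = d * \<phi> (b\<^sup>2)))
       \<and> (\<forall>\<tau>. ext_isom i j \<tau> \<and> \<phi> \<circ> \<tau> = \<tau> \<circ> \<sigma> \<longrightarrow>
            ((\<exists>b. b \<noteq> 0 \<and> \<tau> c = d * \<phi> (b\<^sup>2)) \<longleftrightarrow>
             (\<exists>e. e \<noteq> 0 \<and> \<tau> c * inverse d = e\<^sup>2)))"
proof -
  have ext: "field_hom i" "field_hom j"
    using assms(2,3) by (simp_all add: finite_extension_def)
  have aut: "field_isom \<sigma>" "field_isom \<phi>"
    using assms(4,6) by (simp_all add: ext_Aut_def ext_isom_def)
  show ?thesis
  proof (intro conjI allI impI iffI)
    fix G
    assume "nonassoc_algebra_isom (D_scale i) (D_mul \<sigma> c) (D_scale j) (D_mul \<phi> d) G"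
    then show "\<exists>\<tau> b. ext_isom i j \<tau> \<and> b \<noteq> 0 \<and> (\<forall>x y. G (x, y) = (\<tau> x, \<tau> y * b)) \<and>
        \<phi> \<circ> \<tau> = \<tau> \<circ> \<sigma> \<and> \<tau> c = d * \<phi> (b\<^sup>2)"
      by (rule D_isom_imp_form[OF field_hom_two_neq_zero[OF ext(2) assms(1)]
            aut(1) assms(5) aut(2) assms(7-9)])
  next
    fix G
    assume "\<exists>\<tau> b. ext_isom i j \<tau> \<and> b \<noteq> 0 \<and> (\<forall>x y. G (x, y) = (\<tau> x, \<tau> y * b)) \<and>
        \<phi> \<circ> \<tau> = \<tau> \<circ> \<sigma> \<and> \<tau> c = d * \<phi> (b\<^sup>2)"
    then obtain \<tau> b where "ext_isom i j \<tau>" "b \<noteq> 0" "\<And>x y. G (x, y) = (\<tau> x, \<tau> y * b)"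
        "\<phi> \<circ> \<tau> = \<tau> \<circ> \<sigma>" "\<tau> c = d * \<phi> (b\<^sup>2)"
      by auto
    then show "nonassoc_algebra_isom (D_scale i) (D_mul \<sigma> c) (D_scale j) (D_mul \<phi> d) G"
      by (rule D_isom_of_form[OF ext assms(4,6)])
  \<comment> \<open>What remains are the two directions of the square criterion; after rewriting,
    premise and conclusion coincide.\<close>
  qed (simp_all only: ex_twisted_square_iff[OF aut(2) assms(9)])
qed

end
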